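(* Let $h:\mathbb{R}^n\to\mathbb{R}$ be convex of Legendre type (with full domain) and $L_h$-smooth on $\mathbb{R}^n$ (i.e. $\nabla h$ is $L_h$-Lipschitz). Let $-f:\mathbb{R}^n\to\mathbb{R}$ be convex and anisotropically smooth relative to $h$ with constant $L>0$. Let $g:\mathbb{R}^n\to\overline{\mathbb{R}}$ be proper, lower semicontinuous and convex, such that $x\mapsto g(x)+\tfrac1Lh(L(x-y))$ is level-bounded for every $y\in\mathbb{R}^n$. Put $F=g-f$ and let $x^\star\in\operatorname{argmin}_{\mathbb{R}^n}F$. Let $x^0\in\mathbb{R}^n$ and let $\{x^k\}_{k\in\mathbb{N}_0}$ be generated by $$w^k=\lambda_kx^k+(1-\lambda_k)x^0,\quad y^k=w^k-\tfrac1L\nabla h^*(-\nabla f(w^k)),\quad x^{k+1}\in\operatorname{argmin}_{x\in\mathbb{R}^n}\;g(x)+\tfrac1Lh(L(x-y^k)).$$ Then for all $K\ge1$: (i) If $\lambda_k=1$ for all $k$, then $F(x^K)-F(x^\star)\le\dfrac{2\mathcal{D}_0}{K}$ with $\mathcal{D}_0=LL_h\sup\{\|x-x^\star\|^2:F(x)\le F(x^0)\}$. (ii) If $\lambda_k=\left(\tfrac{k}{k+1}\right)^2$ for all $k$, then $F(x^K)-F(x^\star)\le\dfrac{2LL_h\|x^0-x^\star\|^2}{K}$.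
   Context: $\overline{\mathbb{R}}=\mathbb{R}\cup\{\pm\infty\}$; proper means never $-\infty$ and not identically $+\infty$; level-bounded means all sublevel sets $\{\cdot\le c\}$, $c\in\mathbb{R}$, are bounded. $h^*$ is the convex conjugate of $h$. A proper lsc convex function with full domain is of Legendre type if it is differentiable and strictly convex on $\mathbb{R}^n$; then $\nabla h:\mathbb{R}^n\to\operatorname{int}\operatorname{dom}h^*$ is a bijection with inverse $\nabla h^*$. Standing assumption: $-\infty<\inf F<\infty$. Anisotropic smoothness of $-f$ relative to $h$ with constant $L$: $f$ is continuously differentiable, $-\nabla f(x)\in\operatorname{rge}\nabla h$ for all $x$, and for all $x,\bar x\in\mathbb{R}^n$ $$f(x)\ge f(\bar x)-\tfrac1Lh\big(L(x-\bar x)+\nabla h^*(-\nabla f(\bar x))\big)+\tfrac1Lh\big(\nabla h^*(-\nabla f(\bar x))\big).$$ (Equivalently, $\bar x-\tfrac1L\nabla h^*(-\nabla f(\bar x))$ is a $\Phi$-subgradient of $f$ at $\bar x$ for the coupling $\Phi(x,y)=-\tfrac1Lh(L(x-y))$.) *)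

theory Defs
  imports "HOL-Analysis.Analysis"
begin

(* Unspecified at points where f is not differentiable; differentiability is always stated
   separately. *)
definition gradient :: "('a::real_inner \<Rightarrow> real) \<Rightarrow> 'a \<Rightarrow> 'a" where
  "gradient f x = (THE D. GDERIV f x :> D)"

definition conjugate :: "('a::real_inner \<Rightarrow> real) \<Rightarrow> 'a \<Rightarrow> ereal" where
  "conjugate h y = (SUP x. ereal (y \<bullet> x - h x))"

(* real_of_ereal sends infinite values to 0. A gradient only depends on the values near the
   point, so this is the gradient of the conjugate at interior points of its effective domain. *)
definition conjugate_gradient :: "('a::real_inner \<Rightarrow> real) \<Rightarrow> 'a \<Rightarrow> 'a" where
  "conjugate_gradient h = gradient (\<lambda>y. real_of_ereal (conjugate h y))"

definition strictly_convex :: "('a::real_vector \<Rightarrow> real) \<Rightarrow> bool" where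
  "strictly_convex h \<longleftrightarrow>
     (\<forall>x y t. x \<noteq> y \<longrightarrow> 0 < t \<longrightarrow> t < 1 \<longrightarrow>
        h ((1 - t) *\<^sub>R x + t *\<^sub>R y) < (1 - t) * h x + t * h y)"

(* For real-valued (full domain) functions. Properness is automatic here, and lower
   semicontinuity follows from differentiability. *)
definition legendre :: "('a::real_inner \<Rightarrow> real) \<Rightarrow> bool" where
  "legendre h \<longleftrightarrow>
     convex_on UNIV h \<and> (\<forall>x. h differentiable (at x)) \<and> strictly_convex h"

definition smooth_with :: "real \<Rightarrow> ('a::real_inner \<Rightarrow> real) \<Rightarrow> bool" where
  "smooth_with C h \<longleftrightarrow>
     (\<forall>x. h differentiable (at x)) \<and> C-lipschitz_on UNIV (gradient h)"

(* This is anisotropic smoothness of the function -f, stated in terms of f. *)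
definition neg_anisotropically_smooth ::
    "('a::real_inner \<Rightarrow> real) \<Rightarrow> real \<Rightarrow> ('a \<Rightarrow> real) \<Rightarrow> bool" where
  "neg_anisotropically_smooth h L f \<longleftrightarrow>
     (\<forall>x. f differentiable (at x)) \<and> continuous_on UNIV (gradient f) \<and>
     (\<forall>x. - gradient f x \<in> range (gradient h)) \<and>
     (\<forall>x xb. f x \<ge> f xb
        - 1 / L * h (L *\<^sub>R (x - xb) + conjugate_gradient h (- gradient f xb))
        + 1 / L * h (conjugate_gradient h (- gradient f xb)))"

definition proper :: "('a \<Rightarrow> ereal) \<Rightarrow> bool" where
  "proper g \<longleftrightarrow> (\<forall>x. g x \<noteq> -\<infinity>) \<and> (\<exists>x. g x \<noteq> \<infinity>)"

definition lower_semicontinuous :: "('a::topological_space \<Rightarrow> ereal) \<Rightarrow> bool" where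
  "lower_semicontinuous g \<longleftrightarrow> (\<forall>x. g x \<le> Liminf (at x) g)"

(* Convexity of the epigraph; convex_on only covers real-valued functions. *)
definition ereal_convex :: "('a::real_vector \<Rightarrow> ereal) \<Rightarrow> bool" where
  "ereal_convex g \<longleftrightarrow> convex {(x, r::real). g x \<le> ereal r}"

definition level_bounded :: "('a::metric_space \<Rightarrow> ereal) \<Rightarrow> bool" where
  "level_bounded g \<longleftrightarrow> (\<forall>c::real. bounded {x. g x \<le> ereal c})"

definition argmin :: "('a \<Rightarrow> ereal) \<Rightarrow> 'a set" where
  "argmin g = {x. is_arg_min g (\<lambda>_. True) x}"

end

theory Submission
  imports Defs
begin

text \<open>
  Write \<open>C = L * L\<^sub>h\<close>. Everything rests on the inequality
  \<open>F x\<^sub>k\<^sub>+\<^sub>1 \<le> F u + C/2 \<parallel>u - w\<^sub>k\<parallel>\<^sup>2\<close> for \<^emph>\<open>every\<close> \<open>u\<close>: one step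
  is at least as good as a Euclidean proximal point step on \<open>F\<close>
  from \<open>w\<^sub>k\<close> with parameter \<open>1/C\<close> (lemma \<open>anisotropic_step_inequality\<close>). Put
  \<open>\<phi> v = h (L v) / L\<close>. Anisotropic smoothness at \<open>w\<^sub>k\<close> bounds \<open>F x\<^sub>k\<^sub>+\<^sub>1\<close> by the
  minimal value of \<open>g + \<phi> (\<cdot> - y\<^sub>k)\<close> up to the constant \<open>\<phi> (w\<^sub>k - y\<^sub>k) + f w\<^sub>k\<close>, so
  any \<open>u\<close> may be inserted. Since \<open>\<phi>\<close> has a \<open>C\<close>-Lipschitz gradient, and its gradient
  at \<open>w\<^sub>k - y\<^sub>k\<close> is \<open>- \<nabla>f w\<^sub>k\<close>, the difference \<open>\<phi> (u - y\<^sub>k) - \<phi> (w\<^sub>k - y\<^sub>k)\<close>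
  is at most a linear term plus \<open>C/2 \<parallel>u - w\<^sub>k\<parallel>\<^sup>2\<close>, and convexity of \<open>-f\<close>
  absorbs the linear term. The value of the gradient of \<open>\<phi>\<close> is
  where the conjugate enters: \<open>\<nabla>h\<^sup>*\<close> inverts \<open>\<nabla>h\<close> on its range
  (lemma \<open>conjugate_gradient_gradient\<close>).

  The rates then follow from the convexity of \<open>F\<close> by a choice of \<open>u\<close>. Let
  \<open>r\<^sub>k = F x\<^sub>k - F x\<^sup>\<star>\<close>. For \<open>w\<^sub>k = x\<^sub>k\<close>, the point \<open>u = (1 - t) x\<^sub>k + t x\<^sup>\<star>\<close> gives
  \<open>r\<^sub>k\<^sub>+\<^sub>1 \<le> (1 - t) r\<^sub>k + t\<^sup>2 \<D>\<^sub>0 / 2\<close>, because the values decrease and the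
  iterates stay in the initial level set; the choice \<open>t = 2/(k+2)\<close> is that of the
  conditional gradient method. For the anchored iteration,
  \<open>u = \<lambda>\<^sub>k x\<^sub>k + (1 - \<lambda>\<^sub>k) x\<^sup>\<star>\<close> differs from \<open>w\<^sub>k\<close> by \<open>(1 - \<lambda>\<^sub>k) (x\<^sup>\<star> - x\<^sub>0)\<close>,
  so no bound on the iterates is required, and \<open>k\<^sup>2 r\<^sub>k\<close> grows by at most
  \<open>2 C \<parallel>x\<^sub>0 - x\<^sup>\<star>\<parallel>\<^sup>2\<close> per step.

  The initial value \<open>F x\<^sub>0\<close> may be infinite. Both recursions therefore start at
  \<open>k = 1\<close>, where the step inequality with \<open>u = x\<^sup>\<star>\<close> gives a finite bound.
\<close>

section \<open>Gradients and tangent planes\<close>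

lemma GDERIV_unique:
  assumes "GDERIV f x :> D" "GDERIV f x :> E"
  shows "D = E"
proof -
  have "(\<lambda>v. v \<bullet> D) = (\<lambda>v. v \<bullet> E)"
    using has_derivative_unique[of f "\<lambda>v. v \<bullet> D" x "\<lambda>v. v \<bullet> E"] assms by (simp add: gderiv_def)
  then have "\<forall>v. v \<bullet> D = v \<bullet> E" by (simp add: fun_eq_iff)
  then show ?thesis by (simp only: vector_eq_ldot)
qed

lemma gradient_eq:
  assumes "GDERIV f x :> D"
  shows "gradient f x = D"
  unfolding gradient_def by (rule the_equality) (use assms GDERIV_unique in auto)

lemma GDERIV_gradient:
  fixes f :: "'a::euclidean_space \<Rightarrow> real"
  assumes "f differentiable (at x)"
  shows "GDERIV f x :> gradient f x"
proof -
  obtain f' where f': "(f has_derivative f') (at x)"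
    using assms unfolding differentiable_def by blast
  interpret bounded_linear f' using f' by (rule has_derivative_bounded_linear)
  have "f' = (\<lambda>v. v \<bullet> (\<Sum>b\<in>Basis. f' b *\<^sub>R b))"
  proof
    fix v
    have "f' v = f' (\<Sum>b\<in>Basis. (v \<bullet> b) *\<^sub>R b)" by (simp add: euclidean_representation)
    also have "\<dots> = v \<bullet> (\<Sum>b\<in>Basis. f' b *\<^sub>R b)"
      by (simp add: sum scaleR inner_sum_right mult.commute)
    finally show "f' v = v \<bullet> (\<Sum>b\<in>Basis. f' b *\<^sub>R b)" .
  qed
  then have "GDERIV f x :> (\<Sum>b\<in>Basis. f' b *\<^sub>R b)"
    using f' by (simp add: gderiv_def)
  then show ?thesis using gradient_eq[of f x] by simp
qed

lemma GDERIV_along_line: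
  assumes "GDERIV f (a + t *\<^sub>R d) :> D"
  shows "((\<lambda>s. f (a + s *\<^sub>R d)) has_real_derivative (d \<bullet> D)) (at t)"
proof -
  have "((\<lambda>s. f (a + s *\<^sub>R d)) has_derivative (\<lambda>s. (s *\<^sub>R d) \<bullet> D)) (at t)"
    by (rule has_derivative_compose[of "\<lambda>s. a + s *\<^sub>R d" "\<lambda>s. s *\<^sub>R d" t UNIV f "\<lambda>v. v \<bullet> D"])
       (use assms in \<open>auto simp: gderiv_def intro!: derivative_eq_intros\<close>)
  then show ?thesis by (simp add: has_field_derivative_def mult.commute[of _ "d \<bullet> D"])
qed

lemma convex_above_tangent_plane:
  assumes "convex_on UNIV f" "GDERIV f a :> D"
  shows "f a + (b - a) \<bullet> D \<le> f b"
proof -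
  have cv: "convex_on UNIV (\<lambda>s::real. f (a + s *\<^sub>R (b - a)))"
  proof (rule convex_onI)
    fix t r s :: real assume t: "0 < t" "t < 1"
    have "a + ((1 - t) *\<^sub>R r + t *\<^sub>R s) *\<^sub>R (b - a)
        = (1 - t) *\<^sub>R (a + r *\<^sub>R (b - a)) + t *\<^sub>R (a + s *\<^sub>R (b - a))"
      by (simp add: algebra_simps)
    then show "f (a + ((1 - t) *\<^sub>R r + t *\<^sub>R s) *\<^sub>R (b - a))
        \<le> (1 - t) * f (a + r *\<^sub>R (b - a)) + t * f (a + s *\<^sub>R (b - a))"
      using convex_onD[OF assms(1), of t] t by simp
  qed simp
  have dv: "((\<lambda>s. f (a + s *\<^sub>R (b - a))) has_real_derivative ((b - a) \<bullet> D)) (at 0)"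
    using GDERIV_along_line[of f a 0 "b - a" D] assms(2) by simp
  show ?thesis
    using convex_on_imp_above_tangent[OF cv _ _ _ dv, of 1] by simp
qed

text \<open>
  Along the segment from \<open>a\<close> to \<open>a + d\<close>, the gap between \<open>h\<close> and its quadratic bound
  has derivative of constant sign by the Lipschitz condition.
\<close>

lemma smooth_below_quadratic:
  fixes h :: "'a::euclidean_space \<Rightarrow> real"
  assumes "smooth_with C h"
  shows "h (a + d) \<le> h a + d \<bullet> gradient h a + C / 2 * (norm d)\<^sup>2"
proof -
  have gd: "GDERIV h v :> gradient h v" for v
    using assms by (simp add: smooth_with_def GDERIV_gradient)
  have lip: "norm (gradient h u - gradient h v) \<le> C * norm (u - v)" for u v
    using assms by (auto simp: smooth_with_def dist_norm dest: lipschitz_onD)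
  define q where "q s = h (a + s *\<^sub>R d) - s * (d \<bullet> gradient h a) - C / 2 * s\<^sup>2 * (norm d)\<^sup>2" for s
  have "q 1 \<le> q 0"
  proof (rule DERIV_nonpos_imp_nonincreasing[of 0 1])
    fix s :: real assume s: "0 \<le> s" "s \<le> 1"
    have "(q has_real_derivative
        (d \<bullet> gradient h (a + s *\<^sub>R d) - d \<bullet> gradient h a - C * s * (norm d)\<^sup>2)) (at s)"
      unfolding q_def
      by (rule derivative_eq_intros GDERIV_along_line[OF gd] refl | simp)+
    moreover have "d \<bullet> (gradient h (a + s *\<^sub>R d) - gradient h a) \<le> C * s * (norm d)\<^sup>2"
    proof -
      have "d \<bullet> (gradient h (a + s *\<^sub>R d) - gradient h a)
          \<le> norm d * norm (gradient h (a + s *\<^sub>R d) - gradient h a)"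
        by (rule norm_cauchy_schwarz)
      also have "\<dots> \<le> norm d * (C * norm (s *\<^sub>R d))"
        using lip[of "a + s *\<^sub>R d" a] by (intro mult_left_mono) auto
      also have "\<dots> = C * s * (norm d)\<^sup>2"
        using s by (simp add: power2_eq_square)
      finally show ?thesis .
    qed
    ultimately show "\<exists>y. DERIV q s :> y \<and> y \<le> 0"
      by (metis inner_diff_right diff_le_0_iff_le)
  qed simp
  then show ?thesis by (simp add: q_def)
qed

section \<open>The gradient of the conjugate inverts the gradient\<close>

text \<open>
  If the tangent plane at \<open>p\<close> touched the graph again at \<open>u\<close>, strict convexity would
  put the graph below the plane at the midpoint.
\<close>

lemma legendre_above_tangent_strict:
  fixes h :: "'a::euclidean_space \<Rightarrow> real"
  assumes "legendre h" "u \<noteq> p"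
  shows "h p + (u - p) \<bullet> gradient h p < h u"
proof -
  define m where "m = (1 - 1/2) *\<^sub>R p + (1/2) *\<^sub>R u"
  have "h m < (1 - 1/2) * h p + 1/2 * h u"
  proof -
    have "p \<noteq> u \<longrightarrow> 0 < (1/2::real) \<longrightarrow> (1/2::real) < 1 \<longrightarrow>
        h ((1 - 1/2) *\<^sub>R p + (1/2) *\<^sub>R u) < (1 - 1/2) * h p + 1/2 * h u"
      using assms(1) unfolding legendre_def strictly_convex_def by blast
    then show ?thesis using assms(2) by (simp add: m_def)
  qed
  moreover have "h p + (m - p) \<bullet> gradient h p \<le> h m"
    using assms by (intro convex_above_tangent_plane GDERIV_gradient) (auto simp: legendre_def)
  moreover have "(1 - t) *\<^sub>R p + t *\<^sub>R u - p = t *\<^sub>R (u - p)" for t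
    by (simp add: algebra_simps)
  then have "m - p = (1/2) *\<^sub>R (u - p)"
    unfolding m_def .
  ultimately show ?thesis by simp
qed

text \<open>
  The Bregman gap from \<open>p\<close> is positive on the compact sphere of radius \<open>e\<close>, hence
  bounded away from zero there, and a convex function vanishing at \<open>p\<close> grows at least
  linearly along rays beyond the sphere.
\<close>

lemma legendre_gap_linear_growth:
  fixes h :: "'a::euclidean_space \<Rightarrow> real"
  assumes h: "legendre h" and e: "e > 0"
  obtains c where "c > 0"
    "\<And>u. norm (u - p) \<ge> e \<Longrightarrow> c * norm (u - p) \<le> h u - h p - (u - p) \<bullet> gradient h p"
proof -
  define G where "G u = h u - h p - (u - p) \<bullet> gradient h p" for u
  have diff: "h differentiable (at u)" for u using h by (simp add: legendre_def)
  have "continuous_on (sphere p e) h"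
    using diff by (meson continuous_at_imp_continuous_on differentiable_imp_continuous_within)
  then have "continuous_on (sphere p e) G"
    unfolding G_def by (intro continuous_intros)
  then obtain z where z: "z \<in> sphere p e" "\<And>u. u \<in> sphere p e \<Longrightarrow> G z \<le> G u"
    using continuous_attains_inf[of "sphere p e" G] e by auto
  have "G z > 0"
    using legendre_above_tangent_strict[OF h, of z p] z(1) e by (auto simp: G_def)
  have "G z / e * norm (u - p) \<le> G u" if u: "norm (u - p) \<ge> e" for u
  proof -
    define t where "t = e / norm (u - p)"
    have t: "0 < t" "t \<le> 1" "t * norm (u - p) = e"
      using e less_le_trans[OF e u] u by (auto simp: t_def)
    define v where "v = (1 - t) *\<^sub>R p + t *\<^sub>R u"
    have vp: "v - p = t *\<^sub>R (u - p)" by (simp add: v_def algebra_simps)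
    have "v \<in> sphere p e"
      using t vp by (simp add: dist_norm norm_minus_commute[of p])
    have "h v \<le> (1 - t) * h p + t * h u"
      using h t convex_onD[of UNIV h t p u] by (auto simp: legendre_def v_def)
    then have "G v \<le> t * G u"
      unfolding G_def vp by (simp add: algebra_simps)
    then have "G z \<le> t * G u" using z(2) \<open>v \<in> sphere p e\<close> by force
    then have "G z * norm (u - p) \<le> (t * G u) * norm (u - p)"
      by (rule mult_right_mono) simp
    also have "\<dots> = e * G u" by (simp flip: t(3))
    finally show ?thesis using e by (simp add: field_simps)
  qed
  with \<open>G z > 0\<close> e show thesis by (intro that[of "G z / e"]) (auto simp: G_def)
qed

text \<open>
  Perturbing the slope \<open>\<nabla>h p\<close> by at most the growth rate \<open>c\<close> of the gap cannot
  make a point at distance \<open>e\<close> or more from \<open>p\<close> better than \<open>p\<close> in the supremum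
  that defines the conjugate, and points within \<open>e\<close> gain at most \<open>e\<close> times the
  size of the perturbation. Hence the conjugate is finite near \<open>\<nabla>h p\<close> and deviates
  from the affine function with slope \<open>p\<close> only to first order with factor \<open>e\<close>; as
  \<open>e\<close> is arbitrary, this is differentiability with gradient \<open>p\<close>.
\<close>

lemma conjugate_near_gradient:
  fixes h :: "'a::euclidean_space \<Rightarrow> real"
  assumes h: "legendre h" and e: "e > 0"
  obtains c where "c > 0"
    "\<And>v. norm (v - gradient h p) \<le> c \<Longrightarrow>
       \<exists>r. conjugate h v = ereal r \<and> v \<bullet> p - h p \<le> r
         \<and> r \<le> v \<bullet> p - h p + e * norm (v - gradient h p)"
proof -
  obtain c where c: "c > 0"
    "\<And>u. norm (u - p) \<ge> e \<Longrightarrow> c * norm (u - p) \<le> h u - h p - (u - p) \<bullet> gradient h p"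
    using legendre_gap_linear_growth[OF h e, of p] by metis
  have "\<exists>r. conjugate h v = ereal r \<and> v \<bullet> p - h p \<le> r
         \<and> r \<le> v \<bullet> p - h p + e * norm (v - gradient h p)"
    if v: "norm (v - gradient h p) \<le> c" for v
  proof -
    define w where "w = v - gradient h p"
    have cs: "w \<bullet> (u - p) \<le> norm w * norm (u - p)" for u by (rule norm_cauchy_schwarz)
    have split: "v \<bullet> u - h u = (v \<bullet> p - h p) + w \<bullet> (u - p) - (h u - h p - (u - p) \<bullet> gradient h p)" for u
      by (simp add: w_def inner_diff_left inner_diff_right inner_commute)
    have ub: "v \<bullet> u - h u \<le> v \<bullet> p - h p + e * norm w" for u
    proof (cases "norm (u - p) \<ge> e")
      case True
      have "norm w * norm (u - p) \<le> c * norm (u - p)"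
        using v by (intro mult_right_mono) (auto simp: w_def)
      moreover have "0 \<le> e * norm w" using e by simp
      ultimately show ?thesis using split[of u] cs[of u] c(2)[OF True] by linarith
    next
      case False
      have "norm w * norm (u - p) \<le> e * norm w"
        using mult_left_mono[of "norm (u - p)" e "norm w"] False by (simp add: mult.commute)
      moreover have "0 \<le> h u - h p - (u - p) \<bullet> gradient h p"
        using legendre_above_tangent_strict[OF h, of u p] by (cases "u = p") auto
      ultimately show ?thesis using split[of u] cs[of u] by linarith
    qed
    have up: "conjugate h v \<le> ereal (v \<bullet> p - h p + e * norm w)"
      unfolding conjugate_def using ub by (intro SUP_least) simp
    moreover have lo: "ereal (v \<bullet> p - h p) \<le> conjugate h v"
      unfolding conjugate_def by (rule SUP_upper) simp
    ultimately show ?thesis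
      by (cases "conjugate h v") (auto simp: w_def)
  qed
  with c(1) show thesis by (rule that)
qed

lemma conjugate_gradient_gradient:
  fixes h :: "'a::euclidean_space \<Rightarrow> real"
  assumes h: "legendre h"
  shows "conjugate_gradient h (gradient h p) = p"
proof -
  define H where "H = (\<lambda>v. real_of_ereal (conjugate h v))"
  define v0 where "v0 = gradient h p"
  have "\<exists>d>0. \<forall>v. norm (v - v0) < d \<longrightarrow> norm (H v - H v0 - (v - v0) \<bullet> p) \<le> e * norm (v - v0)"
    if e: "e > 0" for e
  proof -
    obtain c where c: "c > 0"
      "\<And>v. norm (v - v0) \<le> c \<Longrightarrow>
       \<exists>r. conjugate h v = ereal r \<and> v \<bullet> p - h p \<le> r \<and> r \<le> v \<bullet> p - h p + e * norm (v - v0)"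
      using conjugate_near_gradient[OF h e, of p] unfolding v0_def by metis
    have H0: "H v0 = v0 \<bullet> p - h p" using c(2)[of v0] c(1) by (auto simp: H_def)
    have "norm (H v - H v0 - (v - v0) \<bullet> p) \<le> e * norm (v - v0)" if "norm (v - v0) < c" for v
      using c(2)[of v] that unfolding H0 by (auto simp: H_def inner_diff_left)
    with c(1) show ?thesis by blast
  qed
  then have "GDERIV H v0 :> p"
    unfolding gderiv_def has_derivative_at_alt by (auto intro: bounded_linear_inner_left)
  then show ?thesis
    unfolding conjugate_gradient_def H_def v0_def by (rule gradient_eq)
qed


section \<open>Extended-valued convex functions\<close>

lemma argmin_le:
  assumes "z \<in> argmin G"
  shows "G z \<le> (G u :: ereal)"
  using assms by (auto simp: argmin_def is_arg_min_def not_less)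

lemma ereal_convexD:
  assumes "ereal_convex g" "g a \<le> ereal r" "g b \<le> ereal s" "0 \<le> t" "t \<le> 1"
  shows "g ((1 - t) *\<^sub>R a + t *\<^sub>R b) \<le> ereal ((1 - t) * r + t * s)"
  using convexD_alt[of "{(x, r). g x \<le> ereal r}" "(a, r)" "(b, s)" t] assms
  by (simp add: ereal_convex_def)

lemma ereal_convex_diff:
  assumes "ereal_convex g" "convex_on UNIV (\<lambda>u. - f u)"
  shows "ereal_convex (\<lambda>u. g u - ereal (f u))"
  unfolding ereal_convex_def
proof (rule convexI)
  fix p q :: "'a \<times> real" and t t' :: real
  assume "p \<in> {(x, r). g x - ereal (f x) \<le> ereal r}" "q \<in> {(x, r). g x - ereal (f x) \<le> ereal r}"
    and t: "0 \<le> t'" "0 \<le> t" "t' + t = 1"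
  then obtain a b r s where pq: "p = (a, r)" "q = (b, s)"
    and *: "g a - ereal (f a) \<le> ereal r" "g b - ereal (f b) \<le> ereal s"
    by auto
  have t': "t' = 1 - t" using t by simp
  have "g a \<le> ereal (r + f a)" using *(1) by (cases "g a") auto
  moreover have "g b \<le> ereal (s + f b)" using *(2) by (cases "g b") auto
  ultimately have "g ((1 - t) *\<^sub>R a + t *\<^sub>R b) \<le> ereal ((1 - t) * (r + f a) + t * (s + f b))"
    using assms(1) t by (intro ereal_convexD) auto
  moreover have "- f ((1 - t) *\<^sub>R a + t *\<^sub>R b) \<le> (1 - t) * (- f a) + t * (- f b)"
    using convex_onD[OF assms(2), of t a b] t by simp
  ultimately show "t' *\<^sub>R p + t *\<^sub>R q \<in> {(x, r). g x - ereal (f x) \<le> ereal r}"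
    unfolding t' pq by (cases "g ((1 - t) *\<^sub>R a + t *\<^sub>R b)") (auto simp: algebra_simps)
qed

section \<open>One step is as good as a Euclidean proximal step\<close>

text \<open>
  Four bounds are added: the anisotropic lower bound on \<open>f z\<close>, the optimality of \<open>z\<close>,
  the quadratic upper bound on \<open>h\<close> at \<open>p = \<nabla>h\<^sup>* (- \<nabla>f w)\<close>, and the tangent plane of
  \<open>-f\<close> at \<open>w\<close>. The values of \<open>h\<close> at \<open>L (z - y)\<close> and at \<open>p\<close> cancel, and so do the linear
  terms, because \<open>\<nabla>h p = - \<nabla>f w\<close>.
\<close>

lemma anisotropic_step_inequality:
  fixes h f :: "'a::euclidean_space \<Rightarrow> real"
  assumes h: "legendre h" and hC: "smooth_with C h" and L: "L > 0"
    and fc: "convex_on UNIV (\<lambda>u. - f u)" and fa: "neg_anisotropically_smooth h L f"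
    and g: "proper g"
    and y: "y = w - (1 / L) *\<^sub>R conjugate_gradient h (- gradient f w)"
    and z: "z \<in> argmin (\<lambda>u. g u + ereal (1 / L * h (L *\<^sub>R (u - y))))"
  shows "g z - ereal (f z) \<le> (g u - ereal (f u)) + ereal (L * C / 2 * (norm (u - w))\<^sup>2)"
proof -
  have fd: "f differentiable (at w)" using fa by (auto simp: neg_anisotropically_smooth_def)
  obtain p where p: "- gradient f w = gradient h p"
    using fa unfolding neg_anisotropically_smooth_def by blast
  have cp: "conjugate_gradient h (- gradient f w) = p"
    using conjugate_gradient_gradient[OF h] p by simp
  \<comment> \<open>The forward step makes \<open>L (w - y)\<close> equal to \<open>p\<close>, so the proximal term is expanded at \<open>p\<close>.\<close>
  have Ly: "L *\<^sub>R (v - y) = p + L *\<^sub>R (v - w)" for v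
    using L by (simp add: y cp algebra_simps)
  have aniso: "f w - 1 / L * h (p + L *\<^sub>R (z - w)) + 1 / L * h p \<le> f z"
  proof -
    have "f w - 1 / L * h (L *\<^sub>R (z - w) + conjugate_gradient h (- gradient f w))
        + 1 / L * h (conjugate_gradient h (- gradient f w)) \<le> f z"
      using fa unfolding neg_anisotropically_smooth_def by blast
    then show ?thesis by (simp only: cp add.commute[of _ p])
  qed
  have "h (p + L *\<^sub>R (u - w)) \<le> h p + (L *\<^sub>R (u - w)) \<bullet> gradient h p + C / 2 * (norm (L *\<^sub>R (u - w)))\<^sup>2"
    by (rule smooth_below_quadratic[OF hC])
  also have "\<dots> = h p + L * ((u - w) \<bullet> gradient h p + L * C / 2 * (norm (u - w))\<^sup>2)"
    using L by (simp add: power_mult_distrib distrib_left power2_eq_square)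
  finally have quad: "1 / L * h (p + L *\<^sub>R (u - w))
      \<le> 1 / L * h p + (u - w) \<bullet> gradient h p + L * C / 2 * (norm (u - w))\<^sup>2"
    using L by (simp add: field_simps)
  have conc: "- f w + (u - w) \<bullet> gradient h p \<le> - f u"
    using convex_above_tangent_plane[OF fc GDERIV_minus[OF GDERIV_gradient[OF fd]], of u] p by simp
  have prox: "g z + ereal (1 / L * h (p + L *\<^sub>R (z - w))) \<le> g u + ereal (1 / L * h (p + L *\<^sub>R (u - w)))"
    using argmin_le[OF z, of u] by (simp add: Ly)
  have "g z \<noteq> -\<infinity>" "g u \<noteq> -\<infinity>" using g by (auto simp: proper_def)
  with prox aniso quad conc show ?thesis
    by (cases "g z"; cases "g u") auto
qed

section \<open>Two recursions with rate \<open>1/k\<close>\<close>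

text \<open>
  The step size \<open>t = 2/(k+2)\<close> reproduces the bound \<open>2 D / k\<close> because
  \<open>(k + 1) (k + 3) \<le> (k + 2)\<^sup>2\<close>.
\<close>

lemma sublinear_rate_open_loop:
  fixes r :: "nat \<Rightarrow> real"
  assumes D: "D \<ge> 0" and base: "r 1 \<le> D / 2"
    and step: "\<And>k t. k \<ge> 1 \<Longrightarrow> 0 \<le> t \<Longrightarrow> t \<le> 1 \<Longrightarrow> r (Suc k) \<le> (1 - t) * r k + D / 2 * t\<^sup>2"
    and K: "K \<ge> 1"
  shows "r K \<le> 2 * D / K"
  using K
proof (induction K rule: dec_induct)
  case base
  then show ?case using assms(1,2) by simp
next
  case (step k)
  define t where "t = 2 / (real k + 2)"
  have t: "0 \<le> t" "t \<le> 1" by (auto simp: t_def)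
  have k: "real k \<ge> 1" using step by simp
  have "r (Suc k) \<le> (1 - t) * r k + D / 2 * t\<^sup>2"
    using assms(3)[of k t] step t by simp
  also have "\<dots> \<le> (1 - t) * (2 * D / k) + D / 2 * t\<^sup>2"
    using step.IH t by (intro add_right_mono mult_left_mono) auto
  also have "\<dots> = 2 * D * ((real k + 3) / (real k + 2)\<^sup>2)"
    using k by (simp add: t_def power2_eq_square divide_simps) (simp add: algebra_simps)
  also have "\<dots> \<le> 2 * D * (1 / real (Suc k))"
  proof (rule mult_left_mono)
    show "(real k + 3) / (real k + 2)\<^sup>2 \<le> 1 / real (Suc k)"
      using k by (simp add: divide_simps power2_eq_square) (simp add: algebra_simps)
  qed (use D in simp)
  finally show ?case by simp
qed

text \<open>
  After multiplication by \<open>n\<^sup>2\<close>, where \<open>n = k + 1\<close>, the recursion telescopes: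
  \<open>n\<^sup>2 l = k\<^sup>2\<close>, and the error term stays bounded since \<open>n (1 - l) = 2 - 1/n\<close>.
\<close>

lemma sublinear_rate_halpern:
  fixes r :: "nat \<Rightarrow> real"
  assumes E: "E \<ge> 0" and base: "r 1 \<le> E / 2"
    and step: "\<And>k l. k \<ge> 1 \<Longrightarrow> l = (real k / (real k + 1))\<^sup>2 \<Longrightarrow>
      r (Suc k) \<le> l * r k + E / 2 * (1 - l)\<^sup>2"
    and K: "K \<ge> 1"
  shows "r K \<le> 2 * E / K"
proof -
  have "(real K)\<^sup>2 * r K \<le> 2 * E * K"
    using K
  proof (induction K rule: dec_induct)
    case base
    then show ?case using assms(1,2) by simp
  next
    case (step k)
    define n where "n = real k + 1"
    define l where "l = (real k / n)\<^sup>2"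
    have n: "n > 0" by (simp add: n_def)
    have l: "n\<^sup>2 * l = (n - 1)\<^sup>2" using n by (simp add: l_def power_divide n_def)
    have "n\<^sup>2 * (1 - l) = 2 * n - 1"
      using l by (simp add: algebra_simps power2_eq_square)
    then have l': "n * (1 - l) = 2 - 1 / n"
      using n by (simp add: field_simps power2_eq_square)
    have "0 \<le> n * (1 - l)" "n * (1 - l) \<le> 2"
      unfolding l' using n by (auto simp: n_def field_simps)
    then have l4: "(n * (1 - l))\<^sup>2 \<le> 4"
      using power_mono[of "n * (1 - l)" 2 2] by simp
    have "n\<^sup>2 * r (Suc k) \<le> n\<^sup>2 * (l * r k + E / 2 * (1 - l)\<^sup>2)"
      using assms(3)[of k l] step by (intro mult_left_mono) (auto simp: l_def n_def)
    also have "\<dots> = (n\<^sup>2 * l) * r k + E / 2 * (n * (1 - l))\<^sup>2"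
      by (simp add: power_mult_distrib distrib_left mult_ac)
    also have "\<dots> \<le> (n - 1)\<^sup>2 * r k + E / 2 * 4"
      unfolding l using l4 E by (intro add_left_mono mult_left_mono) auto
    also have "\<dots> \<le> 2 * E * k + 2 * E"
      using step.IH by (simp add: n_def)
    finally show ?case by (simp add: n_def algebra_simps)
  qed
  then have "real K * r K \<le> 2 * E"
    using K by (simp add: power2_eq_square mult.assoc)
  then show ?thesis using K by (simp add: field_simps)
qed


section \<open>Rates for iterations with the proximal inequality\<close>

lemma descent_step_finite:
  assumes step: "\<And>k u. F (x (Suc k)) \<le> F u + ereal (C / 2 * (norm (u - w k))\<^sup>2)"
    and min: "\<And>u. F s \<le> F u" and Fs: "F s = ereal m" and K: "k \<ge> (1::nat)"
  shows "\<exists>r. F (x k) = ereal (m + r) \<and> r \<ge> 0"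
proof -
  obtain j where j: "k = Suc j" using K by (cases k) auto
  have "F (x k) < \<infinity>" using step[of j s] Fs j by auto
  with min[of "x k"] Fs show ?thesis
    by (cases "F (x k)") (auto intro!: exI[of _ "real_of_ereal (F (x k)) - m"])
qed

text \<open>
  Comparing \<open>x\<^sub>k\<^sub>+\<^sub>1\<close> with points of the segment from \<open>x\<^sub>k\<close> to the minimizer \<open>s\<close> makes the
  error term scale with \<open>\<parallel>x\<^sub>k - s\<parallel>\<^sup>2\<close>; the values are monotone, so the initial level
  set bounds this distance.
\<close>

lemma descent_step_rate_unanchored:
  fixes x :: "nat \<Rightarrow> 'a::real_inner"
  assumes conv: "ereal_convex F" and C: "C \<ge> 0"
    and step: "\<And>k u. F (x (Suc k)) \<le> F u + ereal (C / 2 * (norm (u - x k))\<^sup>2)"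
    and min: "\<And>u. F s \<le> F u" and Fs: "F s = ereal m" and K: "K \<ge> 1"
  shows "F (x K) - F s
    \<le> 2 * (ereal C * (SUP u\<in>{u. F u \<le> F (x 0)}. ereal ((norm (u - s))\<^sup>2))) / ereal (real K)"
proof -
  define S where "S = (SUP u\<in>{u. F u \<le> F (x 0)}. ereal ((norm (u - s))\<^sup>2))"
  have mono: "F (x k) \<le> F (x 0)" for k
  proof (induction k)
    case (Suc k)
    then show ?case using step[of k "x k"] by (auto intro: order_trans)
  qed simp
  have S_ge: "ereal ((norm (x k - s))\<^sup>2) \<le> S" for k
    unfolding S_def using mono by (intro SUP_upper) auto
  define r where "r k = real_of_ereal (F (x k)) - m" for k
  have r: "F (x k) = ereal (m + r k)" if "k \<ge> 1" for k
    using descent_step_finite[of F x C x s m k] step min Fs that by (auto simp: r_def)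
  have "F (x K) - F s \<le> 2 * (ereal C * S) / ereal (real K)"
  proof (cases S)
    case (real R)
    have R: "(norm (x k - s))\<^sup>2 \<le> R" for k using S_ge[of k] real by simp
    have "r K \<le> 2 * (C * R) / K"
    proof (rule sublinear_rate_open_loop[OF _ _ _ K])
      have "0 \<le> R" using R[of 0] zero_le_power2[of "norm (x 0 - s)"] by linarith
      then show "0 \<le> C * R" using C by simp
      have "m + r 1 \<le> m + C / 2 * (norm (x 0 - s))\<^sup>2"
        using step[of 0 s] r[of 1] Fs by (simp add: norm_minus_commute)
      also have "\<dots> \<le> m + C / 2 * R" using C R[of 0] by (intro add_left_mono mult_left_mono) auto
      finally show "r 1 \<le> C * R / 2" by simp
    next
      fix k :: nat and t :: real
      assume k: "1 \<le> k" and t: "0 \<le> t" "t \<le> 1"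
      define u where "u = (1 - t) *\<^sub>R x k + t *\<^sub>R s"
      have "u - x k = t *\<^sub>R (s - x k)" by (simp add: u_def algebra_simps)
      then have "(norm (u - x k))\<^sup>2 = t\<^sup>2 * (norm (x k - s))\<^sup>2"
        by (simp add: power_mult_distrib norm_minus_commute)
      also have "\<dots> \<le> t\<^sup>2 * R" using R by (intro mult_left_mono) auto
      finally have d: "C / 2 * (norm (u - x k))\<^sup>2 \<le> C / 2 * (t\<^sup>2 * R)"
        using C by (intro mult_left_mono) auto
      have "F u \<le> ereal ((1 - t) * (m + r k) + t * m)"
        unfolding u_def using r[OF k] Fs t by (intro ereal_convexD[OF conv]) auto
      then have "F (x (Suc k)) \<le> ereal ((1 - t) * (m + r k) + t * m) + ereal (C / 2 * (t\<^sup>2 * R))"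
        using d by (intro order_trans[OF step[of k u]] add_mono) auto
      then show "r (Suc k) \<le> (1 - t) * r k + C * R / 2 * t\<^sup>2"
        using r[of "Suc k"] by (simp add: algebra_simps)
    qed
    then show ?thesis using r[OF K] K Fs real by simp
  next
    case PInf
    \<comment> \<open>Since \<open>0 * \<infinity> = 0\<close>, the bound is not vacuous for \<open>C = 0\<close>; a single step then reaches
      the minimum.\<close>
    show ?thesis
    proof (cases "C = 0")
      case True
      obtain j where "K = Suc j" using K by (cases K) auto
      then have "F (x K) - F s \<le> 0" using True step[of j s] r[OF K] Fs by simp
      moreover have "ereal C * S = 0" using True by (simp flip: zero_ereal_def)
      then have "2 * (ereal C * S) / ereal (real K) = 0" by (simp only: ereal_mult_zero ereal_divide_zero_left)
      ultimately show ?thesis by simp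
    next
      case False
      then show ?thesis using C K PInf by simp
    qed
  next
    case MInf
    then show ?thesis using S_ge[of 0] by simp
  qed
  then show ?thesis by (simp add: S_def)
qed

text \<open>
  Replacing the anchor \<open>x\<^sub>0\<close> by the minimizer \<open>s\<close> in \<open>w\<^sub>k\<close> yields a comparison point whose
  distance to \<open>w\<^sub>k\<close> involves only \<open>\<parallel>x\<^sub>0 - s\<parallel>\<close>.
\<close>

lemma descent_step_rate_anchored:
  fixes x :: "nat \<Rightarrow> 'a::real_inner"
  assumes conv: "ereal_convex F" and C: "C \<ge> 0"
    and step: "\<And>k u. F (x (Suc k)) \<le> F u + ereal (C / 2 * (norm (u - w k))\<^sup>2)"
    and w: "\<And>k. w k = lam k *\<^sub>R x k + (1 - lam k) *\<^sub>R x 0"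
    and lam: "\<And>k. lam k = (real k / (real k + 1))\<^sup>2"
    and min: "\<And>u. F s \<le> F u" and Fs: "F s = ereal m" and K: "K \<ge> 1"
  shows "F (x K) - F s \<le> ereal (2 * (C * (norm (x 0 - s))\<^sup>2) / K)"
proof -
  define E where "E = C * (norm (x 0 - s))\<^sup>2"
  define r where "r k = real_of_ereal (F (x k)) - m" for k
  have r: "F (x k) = ereal (m + r k)" if "k \<ge> 1" for k
    using descent_step_finite[of F x C w s m k] step min Fs that by (auto simp: r_def)
  have "r K \<le> 2 * E / K"
  proof (rule sublinear_rate_halpern[OF _ _ _ K])
    show "0 \<le> E" using C by (simp add: E_def)
    show "r 1 \<le> E / 2"
      using step[of 0 s] r[of 1] Fs by (simp add: w lam E_def norm_minus_commute)
  next
    fix k :: nat and l :: real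
    assume k: "1 \<le> k" and "l = (real k / (real k + 1))\<^sup>2"
    then have l: "l = lam k" "0 \<le> l" "l \<le> 1"
      by (auto simp: lam power_le_one)
    define u where "u = (1 - (1 - l)) *\<^sub>R x k + (1 - l) *\<^sub>R s"
    have "u - w k = (1 - l) *\<^sub>R (s - x 0)" by (simp add: u_def w l algebra_simps)
    then have d: "(norm (u - w k))\<^sup>2 = (1 - l)\<^sup>2 * (norm (x 0 - s))\<^sup>2"
      by (simp add: power_mult_distrib norm_minus_commute)
    have "F u \<le> ereal ((1 - (1 - l)) * (m + r k) + (1 - l) * m)"
      unfolding u_def using r[OF k] Fs l by (intro ereal_convexD[OF conv]) auto
    then have "F (x (Suc k)) \<le> ereal ((1 - (1 - l)) * (m + r k) + (1 - l) * m)
        + ereal (C / 2 * ((1 - l)\<^sup>2 * (norm (x 0 - s))\<^sup>2))"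
      using d by (intro order_trans[OF step[of k u]] add_mono) auto
    then show "r (Suc k) \<le> l * r k + E / 2 * (1 - l)\<^sup>2"
      using r[of "Suc k"] by (simp add: algebra_simps E_def)
  qed
  then show ?thesis using r[OF K] Fs by (simp add: E_def)
qed

section \<open>Convergence rates of the anisotropic proximal gradient method\<close>

theorem corollary5p15:
  fixes h f :: "real ^ 'n \<Rightarrow> real"
    and g F :: "real ^ 'n \<Rightarrow> ereal"
    and L L\<^sub>h :: real
    and xstar :: "real ^ 'n"
    and x w y :: "nat \<Rightarrow> real ^ 'n"
    and lam :: "nat \<Rightarrow> real"
  assumes h_legendre: "legendre h"
    and h_smooth: "smooth_with L\<^sub>h h"
    and L_pos: "L > 0"
    and f_convex: "convex_on UNIV (\<lambda>u. - f u)"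
    and f_aniso: "neg_anisotropically_smooth h L f"
    and g_proper: "proper g"
    and g_lsc: "lower_semicontinuous g"
    and g_convex: "ereal_convex g"
    and g_level: "\<And>v. level_bounded (\<lambda>u. g u + ereal (1 / L * h (L *\<^sub>R (u - v))))"
    and F_eq: "F = (\<lambda>u. g u - ereal (f u))"
    and F_inf: "-\<infinity> < (INF u. F u)" "(INF u. F u) < \<infinity>"
    and xstar: "xstar \<in> argmin F"
    and w_eq: "\<And>k. w k = lam k *\<^sub>R x k + (1 - lam k) *\<^sub>R x 0"
    and y_eq: "\<And>k. y k = w k - (1 / L) *\<^sub>R conjugate_gradient h (- gradient f (w k))"
    and x_step: "\<And>k. x (Suc k) \<in> argmin (\<lambda>u. g u + ereal (1 / L * h (L *\<^sub>R (u - y k))))"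
  shows "\<forall>K\<ge>1.
     ((\<forall>k. lam k = 1) \<longrightarrow>
        (let D\<^sub>0 = ereal (L * L\<^sub>h) * (SUP u\<in>{u. F u \<le> F (x 0)}. ereal ((norm (u - xstar))\<^sup>2))
         in F (x K) - F xstar \<le> 2 * D\<^sub>0 / ereal (real K))) \<and>
     ((\<forall>k. lam k = (real k / (real k + 1))\<^sup>2) \<longrightarrow>
        F (x K) - F xstar \<le> ereal (2 * L * L\<^sub>h * (norm (x 0 - xstar))\<^sup>2 / real K))"
proof -
  define C where "C = L * L\<^sub>h"
  have C: "C \<ge> 0"
    using h_smooth L_pos by (auto simp: C_def smooth_with_def dest: lipschitz_on_nonneg)
  have conv: "ereal_convex F"
    unfolding F_eq by (rule ereal_convex_diff[OF g_convex f_convex])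
  have min: "F xstar \<le> F u" for u
    using argmin_le[OF xstar] .
  then have "F xstar = (INF u. F u)"
    by (intro antisym INF_greatest INF_lower) auto
  then have "F xstar \<noteq> -\<infinity>" "F xstar \<noteq> \<infinity>"
    using F_inf by auto
  then obtain m where m: "F xstar = ereal m"
    by (cases "F xstar") auto
  have step: "F (x (Suc k)) \<le> F u + ereal (C / 2 * (norm (u - w k))\<^sup>2)" for k u
    unfolding F_eq C_def
    by (rule anisotropic_step_inequality
        [OF h_legendre h_smooth L_pos f_convex f_aniso g_proper y_eq x_step])
  show ?thesis
  proof (intro allI impI conjI)
    fix K :: nat assume K: "K \<ge> 1" and "\<forall>k. lam k = 1"
    then have "w k = x k" for k by (simp add: w_eq)
    then have "F (x (Suc k)) \<le> F u + ereal (C / 2 * (norm (u - x k))\<^sup>2)" for k u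
      using step[of k u] by simp
    from descent_step_rate_unanchored[where F = F and C = C and x = x and s = xstar, OF conv C this min m K]
    show "let D\<^sub>0 = ereal (L * L\<^sub>h) * (SUP u\<in>{u. F u \<le> F (x 0)}. ereal ((norm (u - xstar))\<^sup>2))
         in F (x K) - F xstar \<le> 2 * D\<^sub>0 / ereal (real K)"
      unfolding C_def Let_def .
  next
    fix K :: nat assume K: "K \<ge> 1" and "\<forall>k. lam k = (real k / (real k + 1))\<^sup>2"
    then have "lam k = (real k / (real k + 1))\<^sup>2" for k by blast
    from descent_step_rate_anchored
        [where F = F and C = C and x = x and w = w and s = xstar, OF conv C step w_eq this min m K]
    show "F (x K) - F xstar \<le> ereal (2 * L * L\<^sub>h * (norm (x 0 - xstar))\<^sup>2 / real K)"
      by (simp add: C_def mult.assoc)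
  qed
qed

end
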